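(* There exist a finite Markov decision process $(\mathcal S,\mathcal A,p,r,\hat{\boldsymbol p})$ with horizon $T=1$ and a risk level $\alpha\in[0,1]$ such that $$\max_{\pi\in\Pi}\ \mathrm{CVaR}_{\alpha}^{\tilde a\sim\boldsymbol\pi(\tilde s)}\big[r(\tilde s,\tilde a,\tilde s')\big]\;<\;\min_{\boldsymbol\zeta\in\mathcal Z_{\mathrm C}}\ \sum_{s\in\mathcal S}\zeta_s\left(\max_{\boldsymbol d\in\Delta_{A}}\mathrm{CVaR}_{\alpha\zeta_s\hat p_s^{-1}}^{\tilde a\sim\boldsymbol d}\big[r(s,\tilde a,\tilde s')\mid\tilde s=s\big]\right),$$ where $\mathcal Z_{\mathrm C}=\{\boldsymbol\zeta\in\Delta_S\mid \alpha\,\zeta_s\le\hat p_s\ \text{for all } s\in\mathcal S\}$.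
   Context: A finite MDP with horizon $T=1$ consists of a finite state set $\mathcal S$ with $S=|\mathcal S|$, a finite action set $\mathcal A$ with $A=|\mathcal A|$, a transition function $p$ where $p(s,a,\cdot)$ is a probability distribution on $\mathcal S$ for each $(s,a)$, a reward function $r:\mathcal S\times\mathcal A\times\mathcal S\to\mathbb R$, and an initial distribution $\hat{\boldsymbol p}$ on $\mathcal S$ with $\hat p_s>0$ for every $s\in\mathcal S$. $\Delta_n$ denotes the $n$-dimensional probability simplex; $\Delta_S$ and $\Delta_A$ are the sets of probability vectors indexed by $\mathcal S$ and $\mathcal A$. $\Pi$ is the set of randomized policies $\boldsymbol\pi:\mathcal S\to\Delta_A$. The random variables are: $\tilde s\sim\hat{\boldsymbol p}$; the action $\tilde a$, distributed according to $\boldsymbol\pi(\tilde s)$ given $\tilde s$ (superscript $\tilde a\sim\boldsymbol\pi(\tilde s)$), or according to $\boldsymbol d$ (superscript $\tilde a\sim\boldsymbol d$); and $\tilde s'\sim p(\tilde s,\tilde a,\cdot)$ given $(\tilde s,\tilde a)$. A risk measure written with "$\mid\tilde s=s$" is evaluated under the conditional distribution given $\tilde s=s$. For a real random variable $\tilde x$ on a finite probability space, $\mathrm{CVaR}_\alpha[\tilde x]=\sup_{z\in\mathbb R}\big(z-\alpha^{-1}\mathbb E[\max\{z-\tilde x,0\}]\big)$ for $\alpha\in(0,1]$, and $\mathrm{CVaR}_0[\tilde x]=\operatorname{ess\,inf}[\tilde x]$ (so $\mathrm{CVaR}_1[\tilde x]=\mathbb E[\tilde x]$). Random variables represent rewards;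 larger values are preferred. *)

theory Defs
  imports "HOL-Probability.Probability"
begin

text \<open>On the finitely supported laws used here and for levels in \<open>[0, 1]\<close>, the real suprema below
  are over nonempty bounded sets. Level 0 is the largest almost sure lower bound; levels outside
  \<open>[0, 1]\<close> carry no meaning.\<close>

definition ess_inf :: "'w measure \<Rightarrow> ('w \<Rightarrow> real) \<Rightarrow> real" where
  "ess_inf M X = Sup {c. AE w in M. c \<le> X w}"

definition cvar :: "real \<Rightarrow> 'w pmf \<Rightarrow> ('w \<Rightarrow> real) \<Rightarrow> real" where
  "cvar \<alpha> P X =
     (if \<alpha> = 0 then ess_inf (measure_pmf P) X
      else (SUP z. z - inverse \<alpha> * measure_pmf.expectation P (\<lambda>w. max (z - X w) 0)))"

text \<open>Probability vectors indexed by \<open>I\<close>, as mass functions supported in \<open>I\<close>.\<close>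

definition prob_simplex :: "'i set \<Rightarrow> 'i pmf set" where
  "prob_simplex I = {q. set_pmf q \<subseteq> I}"

record ('s, 'a) mdp =
  states :: "'s set"
  actions :: "'a set"
  trans_prob :: "'s \<Rightarrow> 'a \<Rightarrow> 's pmf"
  reward :: "'s \<Rightarrow> 'a \<Rightarrow> 's \<Rightarrow> real"
  init :: "'s pmf"

definition finite_mdp :: "('s, 'a) mdp \<Rightarrow> bool" where
  "finite_mdp M \<longleftrightarrow>
     finite (states M) \<and> states M \<noteq> {} \<and> finite (actions M) \<and> actions M \<noteq> {} \<and>
     (\<forall>s\<in>states M. \<forall>a\<in>actions M. trans_prob M s a \<in> prob_simplex (states M)) \<and>
     init M \<in> prob_simplex (states M) \<and> (\<forall>s\<in>states M. pmf (init M) s > 0)"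

text \<open>Values of a policy outside \<open>states M\<close> are left free; they carry no probability.\<close>

definition policies :: "('s, 'a) mdp \<Rightarrow> ('s \<Rightarrow> 'a pmf) set" where
  "policies M = states M \<rightarrow> prob_simplex (actions M)"

text \<open>Joint law of state, action and next state over the single period.\<close>

definition law :: "('s, 'a) mdp \<Rightarrow> ('s \<Rightarrow> 'a pmf) \<Rightarrow> ('s \<times> 'a \<times> 's) pmf" where
  "law M \<pi> =
     bind_pmf (init M) (\<lambda>s. bind_pmf (\<pi> s) (\<lambda>a. map_pmf (\<lambda>s'. (s, a, s')) (trans_prob M s a)))"

definition policy_cvar :: "('s, 'a) mdp \<Rightarrow> real \<Rightarrow> ('s \<Rightarrow> 'a pmf) \<Rightarrow> real" where
  "policy_cvar M \<alpha> \<pi> = cvar \<alpha> (law M \<pi>) (\<lambda>(s, a, s'). reward M s a s')"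

text \<open>The action is drawn from \<open>d\<close> irrespective of the state, and the joint law is then
  conditioned on the state being \<open>s\<close> (an event of positive probability when \<open>s \<in> states M\<close>).\<close>

definition cond_cvar :: "('s, 'a) mdp \<Rightarrow> real \<Rightarrow> 's \<Rightarrow> 'a pmf \<Rightarrow> real" where
  "cond_cvar M \<alpha> s d =
     cvar \<alpha> (cond_pmf (law M (\<lambda>_. d)) {w. fst w = s}) (\<lambda>(_, a, s'). reward M s a s')"

definition Z_C :: "('s, 'a) mdp \<Rightarrow> real \<Rightarrow> 's pmf set" where
  "Z_C M \<alpha> = {\<zeta> \<in> prob_simplex (states M). \<forall>s\<in>states M. \<alpha> * pmf \<zeta> s \<le> pmf (init M) s}"

definition state_level :: "('s, 'a) mdp \<Rightarrow> real \<Rightarrow> 's pmf \<Rightarrow> 's \<Rightarrow> real" where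
  "state_level M \<alpha> \<zeta> s = \<alpha> * pmf \<zeta> s * inverse (pmf (init M) s)"

definition decomp_value :: "('s, 'a) mdp \<Rightarrow> real \<Rightarrow> 's pmf \<Rightarrow> real" where
  "decomp_value M \<alpha> \<zeta> =
     (\<Sum>s\<in>states M. pmf \<zeta> s *
        (SUP d\<in>prob_simplex (actions M). cond_cvar M (state_level M \<alpha> \<zeta> s) s d))"

end

theory Submission
  imports Defs
begin

text \<open>
  By the dual representation of CVaR, the CVaR of a fixed policy is the minimum over \<open>\<zeta>\<close> of the
  decomposed sum for that policy. The theorem therefore compares a max-min, in which the policy is
  fixed before \<open>\<zeta>\<close>, with a min-max, in which the action may depend on \<open>\<zeta>\<close>. For a fixed action in a
  state, \<open>\<zeta>\<^sub>s\<close> times the conditional CVaR is a convex function of \<open>\<zeta>\<^sub>s\<close>, so the min-max minimises the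
  upper envelope of several convex functions, and its value can be strictly larger when two of
  them cross between their minimisers at a height above both minima.

  This happens with two equally likely states, level \<open>1/2\<close> and a choice in state 0 only: the safe
  action 0 pays 1, the risky action 1 pays 0 or 4 with equal probability, and state 1 pays 2. Write
  \<open>t = \<zeta>\<^sub>0\<close>; the level seen in state 0 is then \<open>t\<close> itself. In the decomposed sum the safe action
  contributes \<open>t\<close>, the risky one \<open>max 0 (4 * t - 2)\<close>, and state 1 contributes \<open>2 * (1 - t)\<close>. Hence
  the safe total \<open>t + 2 * (1 - t)\<close> is minimal at \<open>t = 1\<close> with value 1, the risky total
  \<open>max 0 (4 * t - 2) + 2 * (1 - t)\<close> is minimal at \<open>t = 1/2\<close> with value 1, but their upper envelope
  \<open>max (2 - t) (2 * t)\<close> is at least \<open>4/3\<close>, with equality at the crossing point \<open>t = 2/3\<close>.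
  Randomising between the actions does not raise the CVaR: every policy has CVaR exactly 1
  (\<open>policy_cvar_gap_mdp\<close>), while the decomposition has value \<open>max (2 - t) (2 * t)\<close>
  (\<open>decomp_value_gap_mdp\<close>). Both values come from the variational definition of CVaR, by
  bounding the objective and exhibiting a \<open>z\<close> that attains the bound.
\<close>

section \<open>CVaR as an attained supremum\<close>

lemma cvar_leI:
  assumes "\<alpha> \<noteq> 0"
    and "\<And>z. z - inverse \<alpha> * measure_pmf.expectation P (\<lambda>w. max (z - X w) 0) \<le> v"
  shows "cvar \<alpha> P X \<le> v"
  unfolding cvar_def using assms by (auto intro: cSUP_least)

lemma cvar_eqI:
  assumes "\<alpha> \<noteq> 0"
    and "\<And>z. z - inverse \<alpha> * measure_pmf.expectation P (\<lambda>w. max (z - X w) 0) \<le> v"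
    and "z\<^sub>0 - inverse \<alpha> * measure_pmf.expectation P (\<lambda>w. max (z\<^sub>0 - X w) 0) = v"
  shows "cvar \<alpha> P X = v"
  unfolding cvar_def using assms by (auto intro!: cSup_eq_maximum)

lemma ess_inf_pmf_le:
  assumes "finite (set_pmf P)" and "w \<in> set_pmf P" and "X w \<le> v"
  shows "ess_inf (measure_pmf P) X \<le> v"
proof -
  have "Min (X ` set_pmf P) \<in> {c. AE w in measure_pmf P. c \<le> X w}"
    using assms(1) by (auto simp: AE_measure_pmf_iff)
  then have "{c. AE w in measure_pmf P. c \<le> X w} \<noteq> {}" by blast
  then show ?thesis
    unfolding ess_inf_def
    by (rule cSup_least) (use assms(2,3) in \<open>force simp: AE_measure_pmf_iff\<close>)
qed

lemma cvar_const:
  assumes "0 \<le> \<alpha>" and "\<alpha> \<le> 1" and X: "\<And>w. w \<in> set_pmf P \<Longrightarrow> X w = c"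
  shows "cvar \<alpha> P X = c"
proof (cases "\<alpha> = 0")
  case True
  have "{b. AE w in measure_pmf P. b \<le> X w} = {..c}"
    using X set_pmf_not_empty[of P] by (auto simp: AE_measure_pmf_iff)
  then show ?thesis using True by (simp add: cvar_def ess_inf_def)
next
  case False
  have E: "measure_pmf.expectation P (\<lambda>w. max (z - X w) 0) = max (z - c) 0" for z
  proof -
    have "measure_pmf.expectation P (\<lambda>w. max (z - X w) 0)
        = measure_pmf.expectation P (\<lambda>_. max (z - c) 0)"
      by (intro integral_cong_AE) (auto simp: AE_measure_pmf_iff X)
    then show ?thesis by simp
  qed
  have "z - inverse \<alpha> * max (z - c) 0 \<le> c" for z
  proof -
    have "1 * max (z - c) 0 \<le> inverse \<alpha> * max (z - c) 0"
      using assms False by (intro mult_right_mono) (auto simp: one_le_inverse_iff)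
    then have "z - c \<le> inverse \<alpha> * max (z - c) 0"
      using max.cobounded1[of "z - c" 0] by (metis mult_1 order_trans)
    then show ?thesis by (simp add: algebra_simps)
  qed
  then show ?thesis
    using False by (intro cvar_eqI[where z\<^sub>0 = c]) (auto simp: E)
qed

lemma SUP_is_arg_max:
  fixes f :: "'b \<Rightarrow> real"
  assumes "is_arg_max f (\<lambda>x. x \<in> A) x"
  shows "(SUP y\<in>A. f y) = f x"
  using assms by (intro cSup_eq_maximum) (auto simp: is_arg_max_linorder)

section \<open>Conditioning on the initial state\<close>

definition state_law :: "('s, 'a) mdp \<Rightarrow> 's \<Rightarrow> 'a pmf \<Rightarrow> ('s \<times> 'a \<times> 's) pmf" where
  "state_law M s d = bind_pmf d (\<lambda>a. map_pmf (\<lambda>s'. (s, a, s')) (trans_prob M s a))"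

lemma law_eq_bind_state_law: "law M \<pi> = bind_pmf (init M) (\<lambda>s. state_law M s (\<pi> s))"
  by (simp add: law_def state_law_def)

lemma fst_state_law: "w \<in> set_pmf (state_law M s d) \<Longrightarrow> fst w = s"
  by (auto simp: state_law_def)

lemma pmf_law: "pmf (law M \<pi>) w = pmf (init M) (fst w) * pmf (state_law M (fst w) (\<pi> (fst w))) w"
proof -
  have "pmf (state_law M s (\<pi> s)) w
      = pmf (state_law M (fst w) (\<pi> (fst w))) w * indicator {fst w} s" for s
  proof (cases "fst w = s")
    case False
    then have "pmf (state_law M s (\<pi> s)) w = 0"
      using fst_state_law by (metis set_pmf_iff)
    then show ?thesis using False by simp
  qed simp
  then have "(\<lambda>s. pmf (state_law M s (\<pi> s)) w)
      = (\<lambda>s. pmf (state_law M (fst w) (\<pi> (fst w))) w * indicator {fst w} s)" ..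
  then show ?thesis
    by (simp only: law_eq_bind_state_law pmf_bind) (simp add: measure_pmf_single)
qed

lemma map_fst_law: "map_pmf fst (law M \<pi>) = init M"
  by (simp add: law_def map_bind_pmf pmf.map_comp o_def bind_return_pmf')

text \<open>The kernel \<open>state_law\<close> keeps the state as first component, so it disintegrates the joint law
  over its first marginal \<open>init M\<close>; conditioning then just selects one fibre.\<close>

lemma cond_law_eq_state_law:
  assumes "pmf (init M) s > 0"
  shows "cond_pmf (law M \<pi>) {w. fst w = s} = state_law M s (\<pi> s)"
proof -
  have m: "measure (measure_pmf (law M \<pi>)) {w. fst w = s} = pmf (init M) s"
    unfolding map_fst_law[of M \<pi>, symmetric] pmf_map by (simp add: vimage_def)
  have "s \<in> set_pmf (map_pmf fst (law M \<pi>))"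
    using assms by (simp add: map_fst_law set_pmf_iff)
  then have ne: "set_pmf (law M \<pi>) \<inter> {w. fst w = s} \<noteq> {}" by auto
  show ?thesis
  proof (rule pmf_eqI)
    fix w
    show "pmf (cond_pmf (law M \<pi>) {w. fst w = s}) w = pmf (state_law M s (\<pi> s)) w"
    proof (cases "fst w = s")
      case True
      then show ?thesis using assms by (simp add: pmf_cond[OF ne] m pmf_law)
    next
      case False
      then have "pmf (state_law M s (\<pi> s)) w = 0"
        using fst_state_law by (metis set_pmf_iff)
      then show ?thesis using False by (simp add: pmf_cond[OF ne])
    qed
  qed
qed

section \<open>A decision process with a gap\<close>

definition gap_mdp :: "(nat, nat) mdp" where
  "gap_mdp = \<lparr>states = {0, 1}, actions = {0, 1},
     trans_prob = (\<lambda>_ _. pmf_of_set {0, 1}),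
     reward = (\<lambda>s a s'. if s = 1 then 2 else if a = 0 then 1 else if s' = 0 then 0 else 4),
     init = pmf_of_set {0, 1}\<rparr>"

lemma gap_mdp_simps:
  "states gap_mdp = {0, 1}" "actions gap_mdp = {0, 1}"
  "trans_prob gap_mdp s a = pmf_of_set {0, 1}"
  "reward gap_mdp s a s' = (if s = 1 then 2 else if a = 0 then 1 else if s' = 0 then 0 else 4)"
  "init gap_mdp = pmf_of_set {0, 1}"
  by (simp_all add: gap_mdp_def)

lemma pmf_init_gap_mdp: "s \<in> {0, 1} \<Longrightarrow> pmf (init gap_mdp) s = 1 / 2"
  by (auto simp: gap_mdp_simps)

lemma finite_gap_mdp: "finite_mdp gap_mdp"
  by (auto simp: finite_mdp_def prob_simplex_def gap_mdp_simps)

lemma pmf_0_1: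
  fixes q :: "nat pmf"
  assumes "q \<in> prob_simplex {0, 1}"
  shows "pmf q 0 = 1 - pmf q 1"
  using sum_pmf_eq_1[of "{0, 1}" q] assms by (simp add: prob_simplex_def)

lemma expectation_state_law_gap_mdp:
  fixes h :: "nat \<times> nat \<times> nat \<Rightarrow> real"
  assumes "d \<in> prob_simplex {0, 1}"
  shows "measure_pmf.expectation (state_law gap_mdp s d) h
    = (1 - pmf d 1) * ((h (s, 0, 0) + h (s, 0, 1)) / 2) + pmf d 1 * ((h (s, 1, 0) + h (s, 1, 1)) / 2)"
  unfolding state_law_def
  using assms pmf_0_1[OF assms]
  by (subst pmf_expectation_bind[where A = "{0, 1}"])
     (auto simp: prob_simplex_def gap_mdp_simps integral_pmf_of_set)

lemma finite_set_state_law_gap_mdp: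
  "d \<in> prob_simplex {0, 1} \<Longrightarrow> finite (set_pmf (state_law gap_mdp s d))"
  by (auto simp: state_law_def gap_mdp_simps prob_simplex_def intro: finite_subset)

section \<open>The value of a policy\<close>

text \<open>The objective \<open>z - 2 * E[max (z - r) 0]\<close> is affine in the probability \<open>w\<close> of the risky action,
  and at \<open>w = 0\<close> and \<open>w = 1\<close> it is bounded by 1. At \<open>z = 2\<close> it equals 1 for every \<open>w\<close>.\<close>

lemma policy_cvar_gap_mdp:
  assumes "\<pi> \<in> policies gap_mdp"
  shows "policy_cvar gap_mdp (1 / 2) \<pi> = 1"
proof -
  define w where "w = pmf (\<pi> 0) 1"
  have w: "0 \<le> w" "w \<le> 1" by (simp_all add: w_def pmf_le_1)
  have \<pi>: "\<pi> 0 \<in> prob_simplex {0, 1}" "\<pi> 1 \<in> prob_simplex {0, 1}"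
    using assms by (auto simp: policies_def gap_mdp_simps)
  have E: "inverse (1 / 2) * measure_pmf.expectation (law gap_mdp \<pi>)
        (\<lambda>x. max (z - (case x of (s, a, s') \<Rightarrow> reward gap_mdp s a s')) 0)
      = (1 - w) * max (z - 1) 0 + w * ((max z 0 + max (z - 4) 0) / 2) + max (z - 2) 0" for z
    unfolding law_eq_bind_state_law
    using \<pi> finite_set_state_law_gap_mdp
    by (subst pmf_expectation_bind[where A = "{0, 1}"])
       (auto simp: expectation_state_law_gap_mdp pmf_init_gap_mdp gap_mdp_simps(4) w_def
          gap_mdp_simps(5) field_simps simp flip: One_nat_def)
  have "z - ((1 - w) * max (z - 1) 0 + w * ((max z 0 + max (z - 4) 0) / 2) + max (z - 2) 0) \<le> 1" for z
  proof -
    have "(1 - w) * (z - max (z - 1) 0 - max (z - 2) 0) \<le> (1 - w) * 1"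
      using w by (intro mult_left_mono) auto
    moreover have "w * (z - (max z 0 + max (z - 4) 0) / 2 - max (z - 2) 0) \<le> w * 1"
      using w by (intro mult_left_mono) (auto simp: max_def field_simps)
    ultimately show ?thesis by (simp add: algebra_simps)
  qed
  then show ?thesis
    unfolding policy_cvar_def
    by (intro cvar_eqI[where z\<^sub>0 = 2]) (simp_all only: E, simp_all)
qed

section \<open>The value of the decomposition\<close>

lemma cond_cvar_gap_mdp:
  assumes "s \<in> {0, 1}"
  shows "cond_cvar gap_mdp \<beta> s d
    = cvar \<beta> (state_law gap_mdp s d) (\<lambda>(_, a, s'). reward gap_mdp s a s')"
  unfolding cond_cvar_def using assms
  by (subst cond_law_eq_state_law) (simp_all add: pmf_init_gap_mdp)

lemma cond_cvar_gap_mdp_1: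
  assumes "0 \<le> t" and "t \<le> 1"
  shows "cond_cvar gap_mdp t 1 d = 2"
  using assms by (auto simp: cond_cvar_gap_mdp gap_mdp_simps split_def intro: cvar_const)

lemma cond_cvar_safe:
  assumes "0 \<le> t" and "t \<le> 1"
  shows "cond_cvar gap_mdp t 0 (return_pmf 0) = 1"
  using assms
  by (auto simp: cond_cvar_gap_mdp state_law_def bind_return_pmf gap_mdp_simps intro!: cvar_const)

lemma expectation_shortfall_gap_mdp_0:
  assumes "d \<in> prob_simplex {0, 1}"
  shows "measure_pmf.expectation (state_law gap_mdp 0 d)
      (\<lambda>x. max (z - (case x of (_, a, s') \<Rightarrow> reward gap_mdp 0 a s')) 0)
    = (1 - pmf d 1) * max (z - 1) 0 + pmf d 1 * ((max z 0 + max (z - 4) 0) / 2)"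
  by (simp add: expectation_state_law_gap_mdp[OF assms] gap_mdp_simps(4))

text \<open>The bound is the larger of the CVaRs \<open>1\<close> and \<open>max 0 (4 - 2 / t)\<close> of the two pure actions: the
  objective is affine in the probability of the risky action, so it lies below the larger of the
  objectives of the pure actions. Multiplying by \<open>t\<close> makes these piecewise linear in \<open>z\<close>.\<close>

lemma shortfall_objective_le:
  assumes t: "0 < t" "t \<le> 1" and d: "d \<in> prob_simplex {0, 1}"
  shows "z - inverse t * measure_pmf.expectation (state_law gap_mdp 0 d)
      (\<lambda>x. max (z - (case x of (_, a, s') \<Rightarrow> reward gap_mdp 0 a s')) 0) \<le> max 1 (4 - 2 / t)"
proof -
  define w where "w = pmf d 1"
  have w: "0 \<le> w" "w \<le> 1" by (simp_all add: w_def pmf_le_1)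
  define v where "v = max 1 (4 - 2 / t)"
  have tv: "t * v = max t (4 * t - 2)"
    using t by (auto simp: v_def max_def field_simps)
  have safe: "t * z - max (z - 1) 0 \<le> t * v"
  proof -
    have "t * (z - 1) \<le> max (z - 1) 0"
      using t mult_left_le_one_le[of "z - 1" t] mult_nonneg_nonpos[of t "z - 1"]
      by (cases "z \<ge> 1") auto
    then show ?thesis unfolding tv by (simp add: algebra_simps)
  qed
  have risky: "t * z - (max z 0 + max (z - 4) 0) / 2 \<le> t * v"
  proof -
    consider "z \<le> 0" | "0 \<le> z" "z \<le> 4" | "4 \<le> z" by linarith
    then show ?thesis
    proof cases
      case 1
      then have "t * z \<le> 0" using t by (simp add: mult_nonneg_nonpos)
      then show ?thesis using 1 t unfolding tv by simp
    next
      case 2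
      have "(t - 1 / 2) * z \<le> max t (4 * t - 2)"
      proof (cases "t \<ge> 1 / 2")
        case True
        then have "(t - 1 / 2) * z \<le> (t - 1 / 2) * 4"
          using 2 by (intro mult_left_mono) auto
        then show ?thesis by simp
      next
        case False
        then have "(t - 1 / 2) * z \<le> 0" using 2 by (intro mult_nonpos_nonneg) auto
        then show ?thesis using t by simp
      qed
      then show ?thesis using 2 unfolding tv by (simp add: algebra_simps)
    next
      case 3
      then have "(1 - t) * 4 \<le> (1 - t) * z"
        using t by (intro mult_left_mono) auto
      moreover have "4 * t - 2 \<le> t * v" unfolding tv by simp
      ultimately show ?thesis using 3 by (simp add: field_simps)
    qed
  qed
  have "(1 - w) * (t * z - max (z - 1) 0) + w * (t * z - (max z 0 + max (z - 4) 0) / 2)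
      \<le> (1 - w) * (t * v) + w * (t * v)"
    using safe risky w by (intro add_mono mult_left_mono) auto
  then have "t * z - ((1 - w) * max (z - 1) 0 + w * ((max z 0 + max (z - 4) 0) / 2)) \<le> t * v"
    by (simp add: algebra_simps)
  then show ?thesis
    using t unfolding expectation_shortfall_gap_mdp_0[OF d] v_def[symmetric] w_def[symmetric]
    by (simp add: field_simps)
qed

lemma cond_cvar_gap_mdp_0_le:
  assumes "0 < t" and "t \<le> 1" and "d \<in> prob_simplex {0, 1}"
  shows "cond_cvar gap_mdp t 0 d \<le> max 1 (4 - 2 / t)"
  using assms shortfall_objective_le[OF assms] by (auto simp: cond_cvar_gap_mdp intro: cvar_leI)

text \<open>At level 0 only the worst outcome counts, and either action can lead to a reward of at most 1.\<close>

lemma cond_cvar_gap_mdp_0_level_0_le: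
  assumes d: "d \<in> prob_simplex {0, 1}"
  shows "cond_cvar gap_mdp 0 0 d \<le> 1"
proof -
  obtain a where a: "a \<in> set_pmf d" "a = 0 \<or> a = 1"
    using d set_pmf_not_empty[of d] by (auto simp: prob_simplex_def)
  then have "(0, a, 0) \<in> set_pmf (state_law gap_mdp 0 d)"
    by (auto simp: state_law_def gap_mdp_simps)
  then have "ess_inf (measure_pmf (state_law gap_mdp 0 d)) (\<lambda>(_, a, s'). reward gap_mdp 0 a s') \<le> 1"
    using a(2) finite_set_state_law_gap_mdp[OF d]
    by (intro ess_inf_pmf_le) (auto simp: gap_mdp_simps)
  then show ?thesis by (simp add: cond_cvar_gap_mdp cvar_def)
qed

text \<open>Above the crossing point \<open>2 / 3\<close> the risky action attains the bound, at the upper outcome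
  \<open>z = 4\<close>.\<close>

lemma cond_cvar_risky:
  assumes "2 / 3 \<le> t" and "t \<le> 1"
  shows "cond_cvar gap_mdp t 0 (return_pmf 1) = 4 - 2 / t"
proof -
  have d: "return_pmf 1 \<in> prob_simplex {0, 1 :: nat}" by (simp add: prob_simplex_def)
  have t: "0 < t" using assms by simp
  have v: "max 1 (4 - 2 / t) = 4 - 2 / t" using assms t by (simp add: field_simps)
  show ?thesis
    using t shortfall_objective_le[OF t assms(2) d]
    unfolding v cond_cvar_gap_mdp[OF insertI1]
    by (intro cvar_eqI[where z\<^sub>0 = 4])
       (simp_all add: expectation_shortfall_gap_mdp_0[OF d] field_simps del: One_nat_def)
qed

lemma is_arg_max_cond_cvar_0:
  assumes "0 \<le> t" and "t \<le> 1"
  shows "is_arg_max (cond_cvar gap_mdp t 0) (\<lambda>d. d \<in> prob_simplex (actions gap_mdp))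
    (return_pmf (if t \<le> 2 / 3 then 0 else 1))"
proof (cases "t \<le> 2 / 3")
  case True
  have "cond_cvar gap_mdp t 0 d \<le> 1" if "d \<in> prob_simplex {0, 1}" for d
  proof (cases "t = 0")
    case True
    then show ?thesis using cond_cvar_gap_mdp_0_level_0_le[OF that] by simp
  next
    case False
    then have "max 1 (4 - 2 / t) = 1" using assms True by (simp add: field_simps)
    then show ?thesis using cond_cvar_gap_mdp_0_le[OF _ assms(2) that] False assms(1) by simp
  qed
  then show ?thesis
    using True cond_cvar_safe[OF assms]
    by (simp add: is_arg_max_linorder gap_mdp_simps(2)) (simp add: prob_simplex_def)
next
  case False
  then have "max 1 (4 - 2 / t) = 4 - 2 / t" by (simp add: field_simps)
  then show ?thesis
    using False cond_cvar_risky[of t] cond_cvar_gap_mdp_0_le[OF _ assms(2)] assms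
    by (simp add: is_arg_max_linorder gap_mdp_simps(2) del: One_nat_def) (simp add: prob_simplex_def)
qed

lemma SUP_cond_cvar_0:
  assumes "0 \<le> t" and "t \<le> 1"
  shows "t * (SUP d\<in>prob_simplex (actions gap_mdp). cond_cvar gap_mdp t 0 d) = max t (4 * t - 2)"
  unfolding SUP_is_arg_max[OF is_arg_max_cond_cvar_0[OF assms]]
  using assms cond_cvar_safe[of t] cond_cvar_risky[of t]
  by (auto simp: max_def field_simps simp del: One_nat_def)

lemma state_level_gap_mdp: "s \<in> {0, 1} \<Longrightarrow> state_level gap_mdp (1 / 2) \<zeta> s = pmf \<zeta> s"
  by (simp add: state_level_def pmf_init_gap_mdp del: insert_iff)

lemma decomp_value_gap_mdp:
  assumes "\<zeta> \<in> Z_C gap_mdp (1 / 2)"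
  shows "decomp_value gap_mdp (1 / 2) \<zeta> = max (2 - pmf \<zeta> 0) (2 * pmf \<zeta> 0)"
proof -
  have "\<zeta> \<in> prob_simplex {0, 1}" using assms by (simp add: Z_C_def gap_mdp_simps)
  note \<zeta> = pmf_0_1[OF this]
  have "prob_simplex (actions gap_mdp) \<noteq> {}"
    by (auto simp: prob_simplex_def gap_mdp_simps intro!: exI[of _ "return_pmf 0"])
  then have "(SUP d\<in>prob_simplex (actions gap_mdp). cond_cvar gap_mdp (pmf \<zeta> 1) 1 d) = 2"
    using cond_cvar_gap_mdp_1[of "pmf \<zeta> 1"] by (simp add: pmf_le_1 del: One_nat_def)
  then have "decomp_value gap_mdp (1 / 2) \<zeta> = max (pmf \<zeta> 0) (4 * pmf \<zeta> 0 - 2) + pmf \<zeta> 1 * 2"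
    using SUP_cond_cvar_0[of "pmf \<zeta> 0"]
    by (simp add: decomp_value_def gap_mdp_simps(1) state_level_gap_mdp pmf_le_1 del: One_nat_def)
  then show ?thesis using \<zeta> by simp
qed

theorem theorem3p2:
  "\<exists>(M :: (nat, nat) mdp) (\<alpha> :: real).
     finite_mdp M \<and> 0 \<le> \<alpha> \<and> \<alpha> \<le> 1 \<and>
     (\<exists>\<pi>. is_arg_max (policy_cvar M \<alpha>) (\<lambda>\<pi>. \<pi> \<in> policies M) \<pi>) \<and>
     (\<forall>\<zeta>\<in>Z_C M \<alpha>. \<forall>s\<in>states M.
        \<exists>d. is_arg_max (cond_cvar M (state_level M \<alpha> \<zeta> s) s) (\<lambda>d. d \<in> prob_simplex (actions M)) d) \<and>
     (\<exists>\<zeta>. is_arg_min (decomp_value M \<alpha>) (\<lambda>\<zeta>. \<zeta> \<in> Z_C M \<alpha>) \<zeta>) \<and>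
     (SUP \<pi>\<in>policies M. policy_cvar M \<alpha> \<pi>) < (INF \<zeta>\<in>Z_C M \<alpha>. decomp_value M \<alpha> \<zeta>)"
proof -
  let ?M = gap_mdp and ?\<alpha> = "1 / 2 :: real"
  have \<pi>: "(\<lambda>_. return_pmf 0) \<in> policies ?M"
    by (auto simp: policies_def prob_simplex_def gap_mdp_simps)
  then have max_policy: "is_arg_max (policy_cvar ?M ?\<alpha>) (\<lambda>\<pi>. \<pi> \<in> policies ?M) (\<lambda>_. return_pmf 0)"
    by (simp add: is_arg_max_linorder policy_cvar_gap_mdp)
  have max_action: "\<exists>d. is_arg_max (cond_cvar ?M (state_level ?M ?\<alpha> \<zeta> s) s)
      (\<lambda>d. d \<in> prob_simplex (actions ?M)) d" if s: "s \<in> states ?M" for \<zeta> s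
  proof -
    consider "s = 0" | "s = 1" using s by (auto simp: gap_mdp_simps)
    then show ?thesis
    proof cases
      case 1
      then show ?thesis
        using is_arg_max_cond_cvar_0[of "pmf \<zeta> 0"] by (auto simp: state_level_gap_mdp pmf_le_1)
    next
      case 2
      have "is_arg_max (cond_cvar ?M (pmf \<zeta> 1) 1) (\<lambda>d. d \<in> prob_simplex (actions ?M)) (return_pmf 0)"
        by (simp add: is_arg_max_linorder cond_cvar_gap_mdp_1 pmf_le_1 del: One_nat_def)
           (simp add: prob_simplex_def gap_mdp_simps)
      then show ?thesis using 2 by (auto simp: state_level_gap_mdp simp del: One_nat_def)
    qed
  qed
  \<comment> \<open>The weight \<open>2 / 3\<close> on state 0 is the crossing point of the safe and the risky total.\<close>
  define \<zeta>\<^sub>0 :: "nat pmf" where "\<zeta>\<^sub>0 = map_pmf (\<lambda>b. if b then 0 else 1) (bernoulli_pmf (2 / 3))"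
  have \<zeta>\<^sub>0: "\<zeta>\<^sub>0 \<in> Z_C ?M ?\<alpha>"
    using pmf_le_1 by (auto simp: Z_C_def prob_simplex_def \<zeta>\<^sub>0_def gap_mdp_simps)
  have "(\<lambda>b. if b then 0 else 1) -` {0 :: nat} = {True}" by (auto split: if_splits)
  then have "pmf \<zeta>\<^sub>0 0 = 2 / 3"
    by (simp add: \<zeta>\<^sub>0_def pmf_map measure_pmf_single)
  then have value_\<zeta>\<^sub>0: "decomp_value ?M ?\<alpha> \<zeta>\<^sub>0 = 4 / 3"
    by (simp add: decomp_value_gap_mdp[OF \<zeta>\<^sub>0])
  have value_ge: "4 / 3 \<le> decomp_value ?M ?\<alpha> \<zeta>" if "\<zeta> \<in> Z_C ?M ?\<alpha>" for \<zeta>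
    unfolding decomp_value_gap_mdp[OF that] by linarith
  have min_weight: "is_arg_min (decomp_value ?M ?\<alpha>) (\<lambda>\<zeta>. \<zeta> \<in> Z_C ?M ?\<alpha>) \<zeta>\<^sub>0"
    using \<zeta>\<^sub>0 value_ge by (simp add: is_arg_min_linorder value_\<zeta>\<^sub>0)
  have "(SUP \<pi>\<in>policies ?M. policy_cvar ?M ?\<alpha> \<pi>) = 1"
    using SUP_is_arg_max[OF max_policy] policy_cvar_gap_mdp[OF \<pi>] by simp
  also have "1 < (4 / 3 :: real)" by simp
  also have "4 / 3 \<le> (INF \<zeta>\<in>Z_C ?M ?\<alpha>. decomp_value ?M ?\<alpha> \<zeta>)"
    using \<zeta>\<^sub>0 value_ge by (intro cINF_greatest) auto
  finally have gap: "(SUP \<pi>\<in>policies ?M. policy_cvar ?M ?\<alpha> \<pi>)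
      < (INF \<zeta>\<in>Z_C ?M ?\<alpha>. decomp_value ?M ?\<alpha> \<zeta>)" .
  have "\<exists>\<pi>. is_arg_max (policy_cvar ?M ?\<alpha>) (\<lambda>\<pi>. \<pi> \<in> policies ?M) \<pi>"
    using max_policy by blast
  moreover have "\<exists>\<zeta>. is_arg_min (decomp_value ?M ?\<alpha>) (\<lambda>\<zeta>. \<zeta> \<in> Z_C ?M ?\<alpha>) \<zeta>"
    using min_weight by blast
  ultimately show ?thesis
    using max_action gap
    by (intro exI[of _ gap_mdp] exI[of _ "1 / 2"] conjI ballI finite_gap_mdp) simp_all
qed

end
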